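(* Let $(G,\sigma)$ be a finite $d$-regular signed graph ($d\ge1$), equipped with the counting measure on vertices. Then $$2d\,\lambda_1^\sigma\;\ge\;\lambda_\infty^\sigma\;\ge\;\left(\sqrt{1+h_{out}^\sigma}-1\right)^2.$$
   Context: $G=(V,E)$ is a finite undirected graph, possibly with self-loops; $x\sim y$ means $\{x,y\}\in E$ (so $x\sim x$ if there is a self-loop at $x$). The degree of $x$ is $|\{y\in V: y\sim x\}|$ (a self-loop counts once); $G$ is $d$-regular if all degrees equal $d$. A signed graph $(G,\sigma)$ is a graph $G$ with a signature $\sigma:E\to\{+1,-1\}$, and $\sigma_{xy}=\sigma(\{x,y\})$. $\lambda_1^\sigma$ is the smallest eigenvalue of the normalized signed Laplacian $\Delta^\sigma f(x)=\frac1{d}\sum_{y:y\sim x}(f(x)-\sigma_{xy}f(y))$ acting on functions $f:V\to\mathbb R$. $\lambda_\infty^\sigma$ is the optimal (largest) constant such that for all $f:V\to\mathbb R$, $$\lambda_\infty^\sigma\sum_{x\in V}f(x)^2\le\sum_{x\in V}\sup_{y:y\sim x}|f(x)-\sigma_{xy}f(y)|^2 .$$ For $V_1\subseteq V$ let $\partial_{out}(V_1)=\{y\in V\setminus V_1:\exists\,x\in V_1,\ x\sim y\}$ and $$\iota_\infty^\sigma(V_1)=\min_{\tau:V_1\to\{+1,-1\}}\frac12\sum_{x\in V_1}\ \sup_{y\in V_1,\,y\sim x}|\tau(x)-\sigma_{xy}\tau(y)|,$$ where a supremum over the empty set is $0$. The outer vertex isoperimetric constant of the signed graph is $$h_{out}^\sigma=\min_{\emptyset\ne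 V_1\subseteq V}\frac{2\iota_\infty^\sigma(V_1)+|\partial_{out}(V_1)|}{|V_1|}.$$ *)

theory Defs
  imports "HOL-Analysis.Analysis"
begin

text \<open>
  The vertex set of a graph is a finite type \<open>'v\<close>, so that functions on the vertices are the
  functions \<open>'v \<Rightarrow> real\<close>. Edges are sets \<open>{x, y}\<close>; a self-loop at \<open>x\<close> is \<open>{x, x} = {x}\<close>.
  Only the values of a signature on edges are relevant.
\<close>

definition signed_graph :: "'v::finite set set \<Rightarrow> ('v set \<Rightarrow> real) \<Rightarrow> bool" where
  "signed_graph E \<sigma> \<longleftrightarrow> (\<forall>e\<in>E. \<exists>x y. e = {x, y}) \<and> (\<forall>e\<in>E. \<sigma> e \<in> {1, -1})"

definition nbrs :: "'v::finite set set \<Rightarrow> 'v \<Rightarrow> 'v set" where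
  "nbrs E x = {y. {x, y} \<in> E}"

definition degree :: "'v::finite set set \<Rightarrow> 'v \<Rightarrow> nat" where
  "degree E x = card (nbrs E x)"

definition regular :: "'v::finite set set \<Rightarrow> nat \<Rightarrow> bool" where
  "regular E d \<longleftrightarrow> (\<forall>x. degree E x = d)"

definition laplacian ::
  "'v::finite set set \<Rightarrow> ('v set \<Rightarrow> real) \<Rightarrow> nat \<Rightarrow> ('v \<Rightarrow> real) \<Rightarrow> 'v \<Rightarrow> real" where
  "laplacian E \<sigma> d f x = (1 / real d) * (\<Sum>y\<in>nbrs E x. f x - \<sigma> {x, y} * f y)"

definition is_eigenvalue :: "(('v::finite \<Rightarrow> real) \<Rightarrow> 'v \<Rightarrow> real) \<Rightarrow> real \<Rightarrow> bool" where
  "is_eigenvalue L \<mu> \<longleftrightarrow> (\<exists>f. f \<noteq> (\<lambda>x. 0) \<and> L f = (\<lambda>x. \<mu> * f x))"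

definition lambda_1 :: "'v::finite set set \<Rightarrow> ('v set \<Rightarrow> real) \<Rightarrow> nat \<Rightarrow> real" where
  "lambda_1 E \<sigma> d = (LEAST \<mu>. is_eigenvalue (laplacian E \<sigma> d) \<mu>)"

text \<open>
  In the library, the supremum of the empty set of reals is an unspecified number;
  here it has to be \<open>0\<close>.
\<close>

definition sup0 :: "'a set \<Rightarrow> ('a \<Rightarrow> real) \<Rightarrow> real" where
  "sup0 A g = (if A = {} then 0 else (SUP y\<in>A. g y))"

definition lambda_inf :: "'v::finite set set \<Rightarrow> ('v set \<Rightarrow> real) \<Rightarrow> real" where
  "lambda_inf E \<sigma> = (GREATEST c. \<forall>f :: 'v \<Rightarrow> real.
     c * (\<Sum>x\<in>UNIV. (f x)\<^sup>2)
       \<le> (\<Sum>x\<in>UNIV. sup0 (nbrs E x) (\<lambda>y. \<bar>f x - \<sigma> {x, y} * f y\<bar>\<^sup>2)))"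

definition outer_boundary :: "'v::finite set set \<Rightarrow> 'v set \<Rightarrow> 'v set" where
  "outer_boundary E V1 = {y. y \<notin> V1 \<and> (\<exists>x\<in>V1. y \<in> nbrs E x)}"

definition iota_inf :: "'v::finite set set \<Rightarrow> ('v set \<Rightarrow> real) \<Rightarrow> 'v set \<Rightarrow> real" where
  "iota_inf E \<sigma> V1 = (MIN \<tau> \<in> V1 \<rightarrow>\<^sub>E {1, -1}.
     1 / 2 * (\<Sum>x\<in>V1. sup0 (V1 \<inter> nbrs E x) (\<lambda>y. \<bar>\<tau> x - \<sigma> {x, y} * \<tau> y\<bar>)))"

definition h_out :: "'v::finite set set \<Rightarrow> ('v set \<Rightarrow> real) \<Rightarrow> real" where
  "h_out E \<sigma> = (MIN V1 \<in> {V1. V1 \<noteq> {}}.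
     (2 * iota_inf E \<sigma> V1 + real (card (outer_boundary E V1))) / real (card V1))"

end

theory Submission
  imports Defs
begin

text \<open>
  The upper bound holds because the supremum over the neighbours is at most the sum over them.

  For the lower bound, let \<open>a = \<bar>f x\<bar>\<close>, let \<open>g\<close> be the supremum at \<open>x\<close>, let \<open>h = h_out\<close> and
  \<open>s = sqrt (1 + h) - 1\<close>, so that \<open>h = s\<^sup>2 + 2 * s\<close>. Apply the definition of \<open>h\<close> to the level sets
  \<open>{x. t < (f x)\<^sup>2}\<close> with \<open>\<tau>\<close> the sign of \<open>f\<close>, and integrate over \<open>t\<close>. The vertex \<open>x\<close> contributes
  at most \<open>(a + g)\<^sup>2 - a\<^sup>2\<close> through the boundary, and at most \<open>2 * (min a (g - a))\<^sup>2\<close> through the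
  frustrated edges, since \<open>\<bar>f x\<bar> + \<bar>f y\<bar> \<le> g\<close> on such an edge. The sum of both is not bounded by
  \<open>g\<^sup>2 + 2 * a * g\<close>, but it is bounded by \<open>(1 + 1 / s) * g\<^sup>2 + s * a\<^sup>2\<close> as long as \<open>h \<le> 2\<close>,
  which the choice of the whole vertex set in the definition of \<open>h\<close> guarantees.
\<close>

section \<open>The least eigenvalue of a self-adjoint operator\<close>

text \<open>By compactness the Rayleigh quotient attains its minimum on the unit sphere, and
  vanishing of its first variation makes the minimiser an eigenvector.\<close>

lemma self_adjoint_min_eigenvector:
  fixes A :: "'a::euclidean_space \<Rightarrow> 'a"
  assumes lin: "linear A" and sym: "\<And>u v. u \<bullet> A v = A u \<bullet> v"
  obtains v \<mu> where "v \<noteq> 0" "A v = \<mu> *\<^sub>R v" "\<And>w. \<mu> * (w \<bullet> w) \<le> w \<bullet> A w"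
proof -
  have "continuous_on (sphere 0 1) (\<lambda>v. v \<bullet> A v)"
    by (intro continuous_intros linear_continuous_on linear_conv_bounded_linear[THEN iffD1] lin)
  moreover have "sphere (0::'a) 1 \<noteq> {}"
    by simp
  ultimately obtain v where v: "norm v = 1" and vmin: "\<And>w. norm w = 1 \<Longrightarrow> v \<bullet> A v \<le> w \<bullet> A w"
    using continuous_attains_inf[of "sphere (0::'a) 1" "\<lambda>v. v \<bullet> A v"] by auto
  define \<mu> where "\<mu> = v \<bullet> A v"
  have ray: "\<mu> * (w \<bullet> w) \<le> w \<bullet> A w" for w
  proof (cases "w = 0")
    case False
    have "\<mu> \<le> (w /\<^sub>R norm w) \<bullet> A (w /\<^sub>R norm w)"
      unfolding \<mu>_def by (rule vmin) (use False in simp)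
    also have "\<dots> = (w \<bullet> A w) / (w \<bullet> w)"
      by (simp add: linear_scale[OF lin] dot_square_norm power2_eq_square divide_simps)
    finally show ?thesis
      using False by (simp add: le_divide_eq)
  qed simp
  define z where "z = A v - \<mu> *\<^sub>R v"
  have vv: "v \<bullet> v = 1"
    using v by (simp add: dot_square_norm)
  have vz: "v \<bullet> z = 0"
    by (simp add: z_def inner_diff_right vv \<mu>_def)
  have vAz: "v \<bullet> A z = z \<bullet> z"
  proof -
    have "v \<bullet> A z = (z + \<mu> *\<^sub>R v) \<bullet> z"
      by (simp add: sym z_def)
    then show ?thesis
      using vz by (simp add: inner_add_left)
  qed
  have zAv: "z \<bullet> A v = z \<bullet> z"
    using sym[of z v] vAz by (simp add: inner_commute)
  define C where "C = z \<bullet> A z - \<mu> * (z \<bullet> z)"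
  \<comment> \<open>Comparing the minimiser \<open>v\<close> with \<open>v + e z\<close> for the
    residual \<open>z\<close>: the linear term in \<open>e\<close> would dominate for small negative
    \<open>e\<close> if \<open>z\<close> were nonzero.\<close>
  have quad: "0 \<le> 2 * e * (z \<bullet> z) + e\<^sup>2 * C" for e
  proof -
    have "\<mu> * ((v + e *\<^sub>R z) \<bullet> (v + e *\<^sub>R z)) \<le> (v + e *\<^sub>R z) \<bullet> A (v + e *\<^sub>R z)"
      by (rule ray)
    moreover have "(v + e *\<^sub>R z) \<bullet> (v + e *\<^sub>R z) = 1 + e\<^sup>2 * (z \<bullet> z)"
      using vz by (simp add: inner_add_left inner_add_right vv inner_commute power2_eq_square)
    moreover have "(v + e *\<^sub>R z) \<bullet> A (v + e *\<^sub>R z) = \<mu> + 2 * e * (z \<bullet> z) + e\<^sup>2 * (z \<bullet> A z)"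
      by (simp add: linear_add[OF lin] linear_scale[OF lin] inner_add_left inner_add_right vAz zAv
          power2_eq_square \<mu>_def algebra_simps)
    ultimately have "\<mu> * (1 + e\<^sup>2 * (z \<bullet> z)) \<le> \<mu> + 2 * e * (z \<bullet> z) + e\<^sup>2 * (z \<bullet> A z)"
      by (simp only:)
    then show ?thesis
      by (simp add: C_def algebra_simps)
  qed
  have "z = 0"
  proof (rule ccontr)
    assume "z \<noteq> 0"
    then have pos: "0 < z \<bullet> z" by simp
    define K where "K = \<bar>C\<bar> + 1"
    have K: "C \<le> K" "0 < K" by (auto simp: K_def)
    \<comment> \<open>The minimiser of \<open>2 * e * (z \<bullet> z) + e\<^sup>2 * K\<close>;
      \<open>K\<close> replaces \<open>C\<close>, which need not be positive.\<close>
    define e where "e = - (z \<bullet> z) / K"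
    have "2 * e * (z \<bullet> z) + e\<^sup>2 * C \<le> 2 * e * (z \<bullet> z) + e\<^sup>2 * K"
      using K by (intro add_left_mono mult_left_mono) auto
    also have "\<dots> = - (z \<bullet> z)\<^sup>2 / K"
      using K by (simp add: e_def field_simps power2_eq_square)
    also have "\<dots> < 0"
      using pos K by (simp add: divide_less_0_iff)
    finally show False using quad[of e] by simp
  qed
  then have "A v = \<mu> *\<^sub>R v" by (simp add: z_def)
  moreover have "v \<noteq> 0" using v by auto
  ultimately show ?thesis using that ray by blast
qed

section \<open>The signed Laplacian as a symmetric operator\<close>

lemma sum_nbrs: "(\<Sum>y\<in>nbrs E x. g y) = (\<Sum>y\<in>UNIV. if {x, y} \<in> E then g y else 0)"
  unfolding nbrs_def by (simp add: sum.If_cases)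

lemma sum_nbrs_swap: "(\<Sum>x\<in>UNIV. \<Sum>y\<in>nbrs E x. F x y) = (\<Sum>x\<in>UNIV. \<Sum>y\<in>nbrs E x. F y x)"
  unfolding sum_nbrs by (subst sum.swap) (simp add: insert_commute)

lemma laplacian_self_adjoint:
  "(\<Sum>x\<in>UNIV. u x * laplacian E \<sigma> d v x) = (\<Sum>x\<in>UNIV. laplacian E \<sigma> d u x * v x)"
proof -
  have "(\<Sum>x\<in>UNIV. \<Sum>y\<in>nbrs E x. u x * (\<sigma> {x, y} * v y))
      = (\<Sum>x\<in>UNIV. \<Sum>y\<in>nbrs E x. \<sigma> {x, y} * u y * v x)"
    by (subst sum_nbrs_swap) (simp add: insert_commute mult_ac)
  then have "(\<Sum>x\<in>UNIV. \<Sum>y\<in>nbrs E x. u x * (v x - \<sigma> {x, y} * v y))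
      = (\<Sum>x\<in>UNIV. \<Sum>y\<in>nbrs E x. (u x - \<sigma> {x, y} * u y) * v x)"
    by (simp add: right_diff_distrib left_diff_distrib sum_subtractf)
  then show ?thesis
    by (simp add: laplacian_def sum_distrib_left sum_distrib_right sum_divide_distrib[symmetric])
qed

text \<open>\<open>LEAST\<close> is meaningful only once a least eigenvalue is known to exist.
  Transported to \<open>real^'a\<close>, the Laplacian is self-adjoint, and the minimal Rayleigh
  quotient is an eigenvalue below all others.\<close>

lemma lambda_1_is_eigenvalue: "is_eigenvalue (laplacian E \<sigma> d) (lambda_1 E \<sigma> d)"
proof -
  define A :: "real^'a \<Rightarrow> real^'a" where "A = (\<lambda>v. \<chi> x. laplacian E \<sigma> d (($) v) x)"
  have "linear A"
    by (rule linearI)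
      (simp_all add: A_def vec_eq_iff laplacian_def sum_distrib_left algebra_simps sum.distrib
        sum_subtractf add_divide_distrib diff_divide_distrib)
  moreover have "u \<bullet> A v = A u \<bullet> v" for u v
    using laplacian_self_adjoint[of "($) u" E \<sigma> d "($) v"] by (simp add: A_def inner_vec_def)
  ultimately obtain v \<mu> where v: "v \<noteq> 0" "A v = \<mu> *\<^sub>R v"
    and ray: "\<And>w. \<mu> * (w \<bullet> w) \<le> w \<bullet> A w"
    using self_adjoint_min_eigenvector by blast
  have ev: "is_eigenvalue (laplacian E \<sigma> d) \<mu>"
    unfolding is_eigenvalue_def
  proof (intro exI conjI)
    show "($) v \<noteq> (\<lambda>x. 0)"
      using v(1) by (metis vec_eq_iff zero_index)
    show "laplacian E \<sigma> d (($) v) = (\<lambda>x. \<mu> * v $ x)"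
      using v(2) by (auto simp: A_def vec_eq_iff)
  qed
  have "\<mu> \<le> \<nu>" if \<nu>: "is_eigenvalue (laplacian E \<sigma> d) \<nu>" for \<nu>
  proof -
    obtain f where f: "f \<noteq> (\<lambda>x. 0)" "laplacian E \<sigma> d f = (\<lambda>x. \<nu> * f x)"
      using \<nu> by (auto simp: is_eigenvalue_def)
    define w where "w = (\<chi> x. f x)"
    have "w \<noteq> 0" using f(1) by (auto simp: w_def vec_eq_iff)
    moreover have "A w = \<nu> *\<^sub>R w"
      using f(2) by (simp add: A_def w_def vec_eq_iff vec_lambda_inverse)
    ultimately show ?thesis using ray[of w] by simp
  qed
  with ev have "lambda_1 E \<sigma> d = \<mu>"
    unfolding lambda_1_def by (intro Least_equality)
  with ev show ?thesis by simp
qed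

section \<open>The optimal constant\<close>

lemma sup0_upper:
  assumes "finite A" "y \<in> A"
  shows "g y \<le> sup0 A g"
  using assms by (auto simp: sup0_def intro!: cSUP_upper)

lemma sup0_least:
  assumes "\<And>y. y \<in> A \<Longrightarrow> g y \<le> c" "0 \<le> c"
  shows "sup0 A g \<le> c"
  using assms by (auto simp: sup0_def intro!: cSUP_least)

lemma sup0_nonneg:
  assumes "finite A" "\<And>y. y \<in> A \<Longrightarrow> 0 \<le> g y"
  shows "0 \<le> sup0 A g"
proof (cases "A = {}")
  case False
  then obtain y where "y \<in> A" by blast
  with assms sup0_upper[of A y g] show ?thesis by force
qed (simp add: sup0_def)

context
  fixes E :: "'v::finite set set" and \<sigma> :: "'v set \<Rightarrow> real"
begin

definition energy :: "('v \<Rightarrow> real) \<Rightarrow> real" where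
  "energy f = (\<Sum>x\<in>UNIV. sup0 (nbrs E x) (\<lambda>y. \<bar>f x - \<sigma> {x, y} * f y\<bar>\<^sup>2))"

lemma energy_nonneg: "0 \<le> energy f"
  unfolding energy_def by (intro sum_nonneg sup0_nonneg) auto

text \<open>The admissible constants contain 0, are bounded above by the quotient of the constant
  function 1, and are cut out by non-strict inequalities. Hence their supremum is admissible and
  \<open>GREATEST\<close> denotes it.\<close>

lemma lambda_inf_greatest:
  shows lambda_inf_le_energy: "lambda_inf E \<sigma> * (\<Sum>x\<in>UNIV. (f x)\<^sup>2) \<le> energy f"
    and le_lambda_inf: "(\<And>f. c * (\<Sum>x\<in>UNIV. (f x)\<^sup>2) \<le> energy f) \<Longrightarrow> c \<le> lambda_inf E \<sigma>"
proof -
  define S where "S = {c. \<forall>f. c * (\<Sum>x\<in>UNIV. (f x)\<^sup>2) \<le> energy f}"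
  have "0 \<in> S" by (simp add: S_def energy_nonneg)
  have le: "c \<le> energy f / (\<Sum>x\<in>UNIV. (f x)\<^sup>2)"
    if "c \<in> S" "0 < (\<Sum>x\<in>UNIV. (f x)\<^sup>2)" for c f
    using that by (simp add: S_def le_divide_eq)
  have "bdd_above S"
    by (rule bdd_aboveI[of _ "energy (\<lambda>_. 1) / (\<Sum>x\<in>(UNIV :: 'v set). 1\<^sup>2)"]) (rule le, auto)
  have "Sup S * (\<Sum>x\<in>UNIV. (f x)\<^sup>2) \<le> energy f" for f
  proof (cases "(\<Sum>x\<in>UNIV. (f x)\<^sup>2) = 0")
    case True
    then show ?thesis using energy_nonneg by simp
  next
    case False
    then have pos: "0 < (\<Sum>x\<in>UNIV. (f x)\<^sup>2)"
      by (simp add: order_less_le sum_nonneg)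
    have "Sup S \<le> energy f / (\<Sum>x\<in>UNIV. (f x)\<^sup>2)"
      using \<open>0 \<in> S\<close> le[OF _ pos] by (intro cSup_least) auto
    then show ?thesis using pos by (simp add: le_divide_eq)
  qed
  then have "Sup S \<in> S" by (simp add: S_def)
  moreover have "lambda_inf E \<sigma> = (GREATEST c. c \<in> S)"
    by (simp add: lambda_inf_def S_def energy_def)
  moreover have "(GREATEST c. c \<in> S) = Sup S"
    using \<open>Sup S \<in> S\<close> cSup_upper[OF _ \<open>bdd_above S\<close>] by (intro Greatest_equality)
  ultimately have *: "lambda_inf E \<sigma> = Sup S" "Sup S \<in> S" by simp_all
  then show "lambda_inf E \<sigma> * (\<Sum>x\<in>UNIV. (f x)\<^sup>2) \<le> energy f"
    by (simp add: S_def)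
  assume "\<And>f. c * (\<Sum>x\<in>UNIV. (f x)\<^sup>2) \<le> energy f"
  then have "c \<in> S" by (simp add: S_def)
  then show "c \<le> lambda_inf E \<sigma>"
    using * cSup_upper[OF _ \<open>bdd_above S\<close>] by simp
qed

text \<open>Since \<open>\<sigma>\<close> squares to 1 on edges, each squared difference splits into
  two mirror-image halves, which have equal sums over ordered adjacent pairs.\<close>

lemma sum_edge_differences:
  assumes "signed_graph E \<sigma>" "regular E d"
  shows "(\<Sum>x\<in>UNIV. \<Sum>y\<in>nbrs E x. \<bar>f x - \<sigma> {x, y} * f y\<bar>\<^sup>2)
    = 2 * real d * (\<Sum>x\<in>UNIV. f x * laplacian E \<sigma> d f x)"
proof -
  have sq: "(\<sigma> {x, y})\<^sup>2 = 1" if "y \<in> nbrs E x" for x y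
  proof -
    have "\<sigma> {x, y} \<in> {1, -1}"
      using assms(1) that unfolding signed_graph_def nbrs_def by blast
    then show ?thesis by auto
  qed
  have "(\<Sum>x\<in>UNIV. \<Sum>y\<in>nbrs E x. \<bar>f x - \<sigma> {x, y} * f y\<bar>\<^sup>2)
      = (\<Sum>x\<in>UNIV. \<Sum>y\<in>nbrs E x. (f x)\<^sup>2 - \<sigma> {x, y} * f x * f y)
        + (\<Sum>x\<in>UNIV. \<Sum>y\<in>nbrs E x. (f y)\<^sup>2 - \<sigma> {y, x} * f y * f x)"
    unfolding sum.distrib[symmetric]
    by (intro sum.cong refl)
      (simp add: power2_diff power_mult_distrib sq insert_commute algebra_simps)
  also have "\<dots> = 2 * (\<Sum>x\<in>UNIV. \<Sum>y\<in>nbrs E x. (f x)\<^sup>2 - \<sigma> {x, y} * f x * f y)"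
    by (subst (2) sum_nbrs_swap) simp
  also have "\<dots> = 2 * (\<Sum>x\<in>UNIV. f x * (\<Sum>y\<in>nbrs E x. f x - \<sigma> {x, y} * f y))"
    by (simp add: sum_distrib_left power2_eq_square algebra_simps)
  also have "\<dots> = 2 * (\<Sum>x\<in>UNIV. f x * (real d * laplacian E \<sigma> d f x))"
  proof -
    have "(\<Sum>y\<in>nbrs E x. f x - \<sigma> {x, y} * f y) = real d * laplacian E \<sigma> d f x" for x
    \<comment> \<open>Cancelling \<open>1 / real d\<close> needs \<open>d\<close> nonzero; for
      \<open>d = 0\<close> both sides are 0, as there are no neighbours.\<close>
    proof (cases "d = 0")
      case True
      then have "nbrs E x = {}"
        using assms(2) by (simp add: regular_def degree_def)
      then show ?thesis by (simp add: True)
    qed (simp add: laplacian_def)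
    then show ?thesis by simp
  qed
  finally show ?thesis
    by (simp add: sum_distrib_left mult_ac)
qed

text \<open>An eigenfunction for \<open>lambda_1\<close> serves as test function for
  \<open>lambda_inf\<close>.\<close>

lemma lambda_inf_le_lambda_1:
  assumes "signed_graph E \<sigma>" "regular E d"
  shows "lambda_inf E \<sigma> \<le> 2 * real d * lambda_1 E \<sigma> d"
proof -
  obtain f where f: "f \<noteq> (\<lambda>x. 0)" "laplacian E \<sigma> d f = (\<lambda>x. lambda_1 E \<sigma> d * f x)"
    using lambda_1_is_eigenvalue[of E \<sigma> d] by (auto simp: is_eigenvalue_def)
  have "lambda_inf E \<sigma> * (\<Sum>x\<in>UNIV. (f x)\<^sup>2) \<le> energy f"
    by (rule lambda_inf_le_energy)
  also have "\<dots> \<le> (\<Sum>x\<in>UNIV. \<Sum>y\<in>nbrs E x. \<bar>f x - \<sigma> {x, y} * f y\<bar>\<^sup>2)"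
    unfolding energy_def by (intro sum_mono sup0_least member_le_sum sum_nonneg) auto
  also have "\<dots> = 2 * real d * lambda_1 E \<sigma> d * (\<Sum>x\<in>UNIV. (f x)\<^sup>2)"
    unfolding sum_edge_differences[OF assms] f(2)
    by (simp add: sum_distrib_left power2_eq_square mult_ac)
  finally show ?thesis
  proof (rule mult_right_le_imp_le)
    obtain x where "f x \<noteq> 0" using f(1) by auto
    then show "0 < (\<Sum>x\<in>UNIV. (f x)\<^sup>2)"
      by (intro sum_pos2[of _ x]) auto
  qed
qed

section \<open>The isoperimetric constant\<close>

text \<open>The minimum ranges over extensional functions, so \<open>\<tau>\<close> is first
  restricted to \<open>V1\<close>; the sum sees only its values there.\<close>

lemma iota_inf_le:
  assumes "\<And>x. x \<in> V1 \<Longrightarrow> \<tau> x \<in> {1, -1}"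
  shows "iota_inf E \<sigma> V1
    \<le> 1 / 2 * (\<Sum>x\<in>V1. sup0 (V1 \<inter> nbrs E x) (\<lambda>y. \<bar>\<tau> x - \<sigma> {x, y} * \<tau> y\<bar>))"
proof -
  let ?J = "\<lambda>\<tau>. 1 / 2 * (\<Sum>x\<in>V1. sup0 (V1 \<inter> nbrs E x) (\<lambda>y. \<bar>\<tau> x - \<sigma> {x, y} * \<tau> y\<bar>))"
  have "finite (V1 \<rightarrow>\<^sub>E {1, -1 :: real})"
    by (intro finite_PiE) auto
  moreover have "restrict \<tau> V1 \<in> V1 \<rightarrow>\<^sub>E {1, -1}"
    using assms by auto
  ultimately have "iota_inf E \<sigma> V1 \<le> ?J (restrict \<tau> V1)"
    unfolding iota_inf_def
    by (intro Min_le finite_imageI imageI[of "restrict \<tau> V1" _ ?J])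
  also have "?J (restrict \<tau> V1) = ?J \<tau>"
    unfolding sup0_def by (auto intro!: sum.cong SUP_cong)
  finally show ?thesis .
qed

lemma iota_inf_nonneg: "0 \<le> iota_inf E \<sigma> V1"
proof -
  have "finite (V1 \<rightarrow>\<^sub>E {1, -1 :: real})" "V1 \<rightarrow>\<^sub>E {1, -1 :: real} \<noteq> {}"
    by (auto intro!: finite_PiE simp: PiE_eq_empty_iff)
  then show ?thesis
    unfolding iota_inf_def by (auto intro!: sum_nonneg sup0_nonneg simp: Min_ge_iff)
qed

lemma h_out_le:
  assumes "V1 \<noteq> {}"
  shows "h_out E \<sigma> * real (card V1)
    \<le> 2 * iota_inf E \<sigma> V1 + real (card (outer_boundary E V1))"
proof -
  have "h_out E \<sigma> \<le> (2 * iota_inf E \<sigma> V1 + real (card (outer_boundary E V1))) / real (card V1)"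
    unfolding h_out_def using assms by (intro Min_le) auto
  then show ?thesis
    using assms by (simp add: le_divide_eq card_gt_0_iff)
qed

lemma h_out_nonneg: "0 \<le> h_out E \<sigma>"
proof -
  have "{V1 :: 'v set. V1 \<noteq> {}} \<noteq> {}" by auto
  then show ?thesis
    unfolding h_out_def by (auto simp: Min_ge_iff iota_inf_nonneg intro!: divide_nonneg_nonneg)
qed

text \<open>The whole vertex set has no outer boundary, and with constant signs each summand is at
  most 2.\<close>

lemma h_out_le_2:
  assumes "signed_graph E \<sigma>"
  shows "h_out E \<sigma> \<le> 2"
proof -
  have "\<bar>1 - \<sigma> {x, y}\<bar> \<le> 2" if "y \<in> nbrs E x" for x y
  proof -
    have "\<sigma> {x, y} \<in> {1, -1}"
      using assms that unfolding signed_graph_def nbrs_def by blast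
    then show ?thesis by auto
  qed
  then have "(\<Sum>x\<in>UNIV. sup0 (UNIV \<inter> nbrs E x) (\<lambda>y. \<bar>1 - \<sigma> {x, y} * 1\<bar>)) \<le> (\<Sum>x\<in>(UNIV::'v set). 2)"
    by (intro sum_mono sup0_least) auto
  then have "2 * iota_inf E \<sigma> UNIV \<le> 2 * real CARD('v)"
    using iota_inf_le[of UNIV "\<lambda>_. 1"] by simp
  moreover have "h_out E \<sigma> * real CARD('v) \<le> 2 * iota_inf E \<sigma> UNIV"
    using h_out_le[of UNIV] by (simp add: outer_boundary_def)
  ultimately have "h_out E \<sigma> * real CARD('v) \<le> 2 * real CARD('v)" by linarith
  then show ?thesis by simp
qed

section \<open>Integration over the level sets\<close>

lemma level_set_inequality:
  fixes f g :: "'v \<Rightarrow> real"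
  assumes sg: "signed_graph E \<sigma>"
    and g: "\<And>x y. y \<in> nbrs E x \<Longrightarrow> \<bar>f x - \<sigma> {x, y} * f y\<bar> \<le> g x"
  shows "h_out E \<sigma> * (\<Sum>x\<in>UNIV. indicator {0..<(f x)\<^sup>2} t)
    \<le> (\<Sum>x\<in>UNIV. indicator {(f x)\<^sup>2..<(\<bar>f x\<bar> + g x)\<^sup>2} t
        + 2 * indicator {0..<(min \<bar>f x\<bar> (max 0 (g x - \<bar>f x\<bar>)))\<^sup>2} t)"
    (is "_ \<le> sum (\<lambda>x. ?B x + 2 * ?M x) UNIV")
\<comment> \<open>Outside these intervals the left side vanishes; inside one of them
  \<open>t\<close> is nonnegative and the level set is nonempty, as \<open>h_out_le\<close>
  requires.\<close>
proof (cases "\<exists>x. t \<in> {0..<(f x)\<^sup>2}")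
  case False
  then have "(\<Sum>x\<in>UNIV. indicator {0..<(f x)\<^sup>2} t) = (0::real)"
    by (intro sum.neutral) (auto simp: indicator_def)
  moreover have "0 \<le> sum (\<lambda>x. ?B x + 2 * ?M x) UNIV"
    by (intro sum_nonneg) auto
  ultimately show ?thesis by simp
next
  case True
  then have "0 \<le> t" by auto
  define V1 where "V1 = {x. t < (f x)\<^sup>2}"
  define \<tau> where "\<tau> = (\<lambda>x. if 0 \<le> f x then 1 else -1 :: real)"
  have "V1 \<noteq> {}" using True by (auto simp: V1_def)
  have sig: "\<sigma> {x, y} = 1 \<or> \<sigma> {x, y} = -1" if "y \<in> nbrs E x" for x y
    using sg that unfolding signed_graph_def nbrs_def by blast
  have "2 * iota_inf E \<sigma> V1
      \<le> (\<Sum>x\<in>V1. sup0 (V1 \<inter> nbrs E x) (\<lambda>y. \<bar>\<tau> x - \<sigma> {x, y} * \<tau> y\<bar>))"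
    using iota_inf_le[of V1 \<tau>] by (fastforce simp: \<tau>_def)
  also have "\<dots> \<le> (\<Sum>x\<in>V1. 2 * ?M x)"
  proof (intro sum_mono sup0_least)
    fix x y assume x: "x \<in> V1" and y: "y \<in> V1 \<inter> nbrs E x"
    show "\<bar>\<tau> x - \<sigma> {x, y} * \<tau> y\<bar> \<le> 2 * ?M x"
    proof (cases "\<tau> x = \<sigma> {x, y} * \<tau> y")
      case False
      \<comment> \<open>On a frustrated edge \<open>f x\<close> and
        \<open>\<sigma> {x, y} * f y\<close> have opposite signs, so their absolute values add
        up.\<close>
      then have "\<bar>f x\<bar> + \<bar>f y\<bar> = \<bar>f x - \<sigma> {x, y} * f y\<bar>"
        using sig[of y x] y by (auto simp: \<tau>_def split: if_splits)
      then have "\<bar>f y\<bar> \<le> g x - \<bar>f x\<bar>" using g[of y x] y by simp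
      then have "min \<bar>f x\<bar> \<bar>f y\<bar> \<le> min \<bar>f x\<bar> (max 0 (g x - \<bar>f x\<bar>))" by auto
      then have "(min \<bar>f x\<bar> \<bar>f y\<bar>)\<^sup>2 \<le> (min \<bar>f x\<bar> (max 0 (g x - \<bar>f x\<bar>)))\<^sup>2"
        by (intro power_mono) auto
      moreover have "t < (min \<bar>f x\<bar> \<bar>f y\<bar>)\<^sup>2"
        using x y by (auto simp: V1_def min_def)
      ultimately have "t < (min \<bar>f x\<bar> (max 0 (g x - \<bar>f x\<bar>)))\<^sup>2" by linarith
      then have "?M x = 1" using \<open>0 \<le> t\<close> by (simp add: indicator_def)
      then show ?thesis using sig[of y x] y by (auto simp: \<tau>_def)
    qed simp
  qed simp
  also have "\<dots> \<le> (\<Sum>x\<in>UNIV. 2 * ?M x)"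
    by (intro sum_mono2) auto
  finally have iota: "2 * iota_inf E \<sigma> V1 \<le> (\<Sum>x\<in>UNIV. 2 * ?M x)" .
  have "real (card (outer_boundary E V1)) = (\<Sum>x\<in>outer_boundary E V1. 1)" by simp
  also have "\<dots> \<le> (\<Sum>x\<in>outer_boundary E V1. ?B x)"
  proof (intro sum_mono)
    fix x assume "x \<in> outer_boundary E V1"
    then obtain y where x: "x \<notin> V1" and y: "y \<in> V1" "y \<in> nbrs E x"
      by (auto simp: outer_boundary_def nbrs_def insert_commute)
    \<comment> \<open>The triangle inequality carries the level from \<open>y\<close> inside to
      \<open>x\<close> outside: \<open>t\<close> is at least \<open>(f x)\<^sup>2\<close> and below
      \<open>(f y)\<^sup>2\<close>.\<close>
    have "\<bar>f y\<bar> \<le> \<bar>f x\<bar> + g x"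
      using g[OF y(2)] sig[OF y(2)] by auto
    then have "(f y)\<^sup>2 \<le> (\<bar>f x\<bar> + g x)\<^sup>2"
      by (metis abs_ge_zero power2_abs power_mono)
    then show "1 \<le> ?B x"
      using x y by (simp add: V1_def indicator_def)
  qed
  also have "\<dots> \<le> (\<Sum>x\<in>UNIV. ?B x)"
    by (intro sum_mono2) auto
  finally have "real (card (outer_boundary E V1)) \<le> (\<Sum>x\<in>UNIV. ?B x)" .
  with iota h_out_le[OF \<open>V1 \<noteq> {}\<close>]
  have "h_out E \<sigma> * real (card V1) \<le> (\<Sum>x\<in>UNIV. ?B x + 2 * ?M x)"
    by (simp add: sum.distrib)
  moreover have "(\<Sum>x\<in>UNIV. indicator {0..<(f x)\<^sup>2} t) = real (card V1)"
    using \<open>0 \<le> t\<close> by (simp add: V1_def indicator_def sum.If_cases)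
  ultimately show ?thesis by simp
qed

text \<open>Layer-cake integration over \<open>t\<close>: each indicator integrates to the length of
  its interval. Nonnegative \<open>g\<close> keeps the endpoints in order.\<close>

lemma integrated_level_set_inequality:
  fixes f g :: "'v \<Rightarrow> real"
  assumes "signed_graph E \<sigma>"
    and "\<And>x y. y \<in> nbrs E x \<Longrightarrow> \<bar>f x - \<sigma> {x, y} * f y\<bar> \<le> g x"
    and g0: "\<And>x. 0 \<le> g x"
  shows "h_out E \<sigma> * (\<Sum>x\<in>UNIV. (f x)\<^sup>2)
    \<le> (\<Sum>x\<in>UNIV. (\<bar>f x\<bar> + g x)\<^sup>2 - (f x)\<^sup>2
        + 2 * (min \<bar>f x\<bar> (max 0 (g x - \<bar>f x\<bar>)))\<^sup>2)"
proof -
  have ind: "has_bochner_integral lborel (indicator {p..<q}) (q - p)" if "p \<le> q" for p q :: real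
    using has_bochner_integral_real_indicator[of "{p..<q}" lborel] that
    by (simp add: emeasure_lborel_Ico)
  have le: "(f x)\<^sup>2 \<le> (\<bar>f x\<bar> + g x)\<^sup>2" for x
    using power_mono[of "\<bar>f x\<bar>" "\<bar>f x\<bar> + g x" 2] g0[of x] by simp
  have L: "has_bochner_integral lborel
      (\<lambda>t. h_out E \<sigma> * (\<Sum>x\<in>UNIV. indicator {0..<(f x)\<^sup>2} t))
      (h_out E \<sigma> * (\<Sum>x\<in>UNIV. (f x)\<^sup>2 - 0))"
    by (intro has_bochner_integral_mult_right has_bochner_integral_sum ind) auto
  have R: "has_bochner_integral lborel
      (\<lambda>t. \<Sum>x\<in>UNIV. indicator {(f x)\<^sup>2..<(\<bar>f x\<bar> + g x)\<^sup>2} t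
        + 2 * indicator {0..<(min \<bar>f x\<bar> (max 0 (g x - \<bar>f x\<bar>)))\<^sup>2} t)
      (\<Sum>x\<in>UNIV. ((\<bar>f x\<bar> + g x)\<^sup>2 - (f x)\<^sup>2)
        + 2 * ((min \<bar>f x\<bar> (max 0 (g x - \<bar>f x\<bar>)))\<^sup>2 - 0))"
    by (intro has_bochner_integral_mult_right has_bochner_integral_sum
        has_bochner_integral_add ind le) auto
  show ?thesis
    using integral_mono[OF integrable.intros[OF L] integrable.intros[OF R]
        level_set_inequality[OF assms(1,2)]]
    unfolding has_bochner_integral_integral_eq[OF L] has_bochner_integral_integral_eq[OF R]
    by simp
qed

end

section \<open>The pointwise estimate and the lower bound\<close>

text \<open>Subtracting \<open>(a + g)\<^sup>2 - a\<^sup>2\<close> from the right side leaves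
  exactly \<open>(g - s * a)\<^sup>2 / s\<close>, which must dominate the frustration term.\<close>

lemma frustration_bound:
  fixes a g s :: real
  assumes "0 \<le> a" "0 < s" "s * s + 2 * s \<le> 2"
  shows "(a + g)\<^sup>2 - a\<^sup>2 + 2 * (min a (max 0 (g - a)))\<^sup>2 \<le> (1 + 1 / s) * g\<^sup>2 + s * a\<^sup>2"
proof -
  define m where "m = min a (max 0 (g - a))"
  \<comment> \<open>A rational between \<open>sqrt 3 - 1\<close>, the largest \<open>s\<close>
    allowed by the hypothesis, and \<open>3 - sqrt 5\<close>, up to which
    \<open>2 * s \<le> (2 - s)\<^sup>2\<close> holds.\<close>
  have s: "s \<le> 3 / 4"
  proof (rule ccontr)
    assume "\<not> s \<le> 3 / 4"
    moreover from this have "9 / 16 \<le> s * s"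
      using mult_mono[of "3 / 4" s "3 / 4" s] by simp
    ultimately show False using assms(3) by linarith
  qed
  txt \<open>It suffices to compare square roots, that is \<open>sqrt (2 * s) * m \<le> \<bar>g - s * a\<bar>\<close>. This is
    a consequence of \<open>g - s * a \<ge> m + (1 - s) * a \<ge> (2 - s) * m\<close> and \<open>2 * s \<le> (2 - s)\<^sup>2\<close>.\<close>
  have key: "2 * s * m\<^sup>2 \<le> (g - s * a)\<^sup>2"
  proof (cases "g \<le> a")
    case True
    then have "m = 0" using assms(1) by (simp add: m_def)
    then show ?thesis by simp
  next
    case False
    then have m: "0 \<le> m" "m \<le> a" "m \<le> g - a" using assms(1) by (auto simp: m_def)
    have "(1 - s) * m \<le> (1 - s) * a"
      using m s by (intro mult_left_mono) auto
    then have "(2 - s) * m \<le> g - s * a" using m by (simp add: algebra_simps)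
    then have "((2 - s) * m)\<^sup>2 \<le> (g - s * a)\<^sup>2"
      using m s by (intro power_mono) auto
    moreover have "2 * s * m\<^sup>2 \<le> (2 - s)\<^sup>2 * m\<^sup>2"
    proof (rule mult_right_mono)
      \<comment> \<open>The tangent to \<open>s * s\<close> at \<open>3 / 4\<close> reduces the
        claim to a linear one.\<close>
      have "0 \<le> (s - 3 / 4) * (s - 3 / 4)" by simp
      then have "3 / 2 * s - 9 / 16 \<le> s * s" by (simp add: algebra_simps)
      moreover have "(2 - s)\<^sup>2 = 4 - 4 * s + s * s"
        by (simp add: power2_eq_square algebra_simps)
      ultimately show "2 * s \<le> (2 - s)\<^sup>2" using s by linarith
    qed simp
    ultimately show ?thesis by (simp add: power_mult_distrib)
  qed
  have "2 * m\<^sup>2 \<le> (g - s * a)\<^sup>2 / s"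
    using key assms(2) by (simp add: le_divide_eq mult_ac)
  also have "\<dots> = g\<^sup>2 / s - 2 * a * g + s * a\<^sup>2"
    using assms(2) by (simp add: power2_eq_square field_simps)
  finally show ?thesis
    unfolding m_def[symmetric] by (simp add: power2_eq_square algebra_simps)
qed

lemma lambda_inf_ge:
  assumes "signed_graph E \<sigma>"
  shows "(sqrt (1 + h_out E \<sigma>) - 1)\<^sup>2 \<le> lambda_inf E \<sigma>"
proof (rule le_lambda_inf)
  fix f :: "'a \<Rightarrow> real"
  define s where "s = sqrt (1 + h_out E \<sigma>) - 1"
  have "0 \<le> s" using h_out_nonneg[of E \<sigma>] by (simp add: s_def)
  have h: "h_out E \<sigma> = s * s + 2 * s"
    using h_out_nonneg[of E \<sigma>] by (simp add: s_def algebra_simps)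
  define g where "g = (\<lambda>x. sqrt (sup0 (nbrs E x) (\<lambda>y. \<bar>f x - \<sigma> {x, y} * f y\<bar>\<^sup>2)))"
  have g0: "0 \<le> g x" for x
    by (auto simp: g_def intro!: sup0_nonneg)
  have gsq: "(g x)\<^sup>2 = sup0 (nbrs E x) (\<lambda>y. \<bar>f x - \<sigma> {x, y} * f y\<bar>\<^sup>2)" for x
    unfolding g_def by (intro real_sqrt_pow2 sup0_nonneg) auto
  have gle: "\<bar>f x - \<sigma> {x, y} * f y\<bar> \<le> g x" if "y \<in> nbrs E x" for x y
    unfolding g_def using that
    by (intro real_le_rsqrt sup0_upper[of "nbrs E x" y "\<lambda>y. \<bar>f x - \<sigma> {x, y} * f y\<bar>\<^sup>2"]) auto
  let ?F = "\<Sum>x\<in>UNIV. (f x)\<^sup>2" and ?G = "\<Sum>x\<in>UNIV. (g x)\<^sup>2"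
  have "s\<^sup>2 * ?F \<le> ?G"
  \<comment> \<open>The pointwise bound divides by \<open>s\<close>; for \<open>s = 0\<close> the
    claim is nonnegativity of \<open>?G\<close>.\<close>
  proof (cases "s = 0")
    case False
    then have "0 < s" using \<open>0 \<le> s\<close> by simp
    have "(s * s + 2 * s) * ?F \<le> (\<Sum>x\<in>UNIV. (\<bar>f x\<bar> + g x)\<^sup>2 - (f x)\<^sup>2
        + 2 * (min \<bar>f x\<bar> (max 0 (g x - \<bar>f x\<bar>)))\<^sup>2)"
      using integrated_level_set_inequality[OF assms gle g0] h by simp
    also have "\<dots> \<le> (\<Sum>x\<in>UNIV. (1 + 1 / s) * (g x)\<^sup>2 + s * (f x)\<^sup>2)"
      using frustration_bound[OF abs_ge_zero \<open>0 < s\<close>] h_out_le_2[OF assms] h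
      by (intro sum_mono) (metis power2_abs)
    also have "\<dots> = (1 + 1 / s) * ?G + s * ?F"
      by (simp add: sum.distrib sum_distrib_left)
    finally have "(s * s + 2 * s) * ?F - s * ?F \<le> (1 + 1 / s) * ?G" by simp
    \<comment> \<open>Here \<open>s\<^sup>2 + s = (1 + 1 / s) * s\<^sup>2\<close>, so the same
      positive factor cancels on both sides.\<close>
    also have "(s * s + 2 * s) * ?F - s * ?F = (1 + 1 / s) * (s\<^sup>2 * ?F)"
      using \<open>0 < s\<close> by (simp add: power2_eq_square field_simps)
    finally have "(1 + 1 / s) * (s\<^sup>2 * ?F) \<le> (1 + 1 / s) * ?G" .
    then show ?thesis
      using \<open>0 < s\<close> by (simp add: mult_le_cancel_left_pos add_pos_pos)
  qed (simp add: sum_nonneg)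
  then show "(sqrt (1 + h_out E \<sigma>) - 1)\<^sup>2 * ?F \<le> energy E \<sigma> f"
    by (simp add: energy_def gsq s_def)
qed

theorem theorem1p2:
  fixes E :: "'v::finite set set" and \<sigma> :: "'v set \<Rightarrow> real" and d :: nat
  assumes "signed_graph E \<sigma>"
    and "regular E d"
    and "d \<ge> 1"
  shows "2 * real d * lambda_1 E \<sigma> d \<ge> lambda_inf E \<sigma>
    \<and> lambda_inf E \<sigma> \<ge> (sqrt (1 + h_out E \<sigma>) - 1)\<^sup>2"
  using lambda_inf_le_lambda_1[OF assms(1,2)] lambda_inf_ge[OF assms(1)] by simp

end
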